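(* Let $n>1$ and let $\varphi:\mathcal A\to M_n(\mathbb C)$ be a map (not assumed linear) that is continuous, multiplicative (i.e. $\varphi(AB)=\varphi(A)\varphi(B)$ for all $A,B\in\mathcal A$), and norm preserving (i.e. $\|\varphi(A)\|=\|A\|$ for all $A\in\mathcal A$). Then there exists a unitary $U\in M_n(\mathbb C)$ such that either $\varphi(A)=UAU^*$ for all $A\in\mathcal A$, or $\varphi(A)=U\overline{A}U^*$ for all $A\in\mathcal A$, where $\overline{A}$ denotes the entrywise complex conjugate of $A$.
   Context: $S$ denotes the $n\times n$ nilpotent Jordan block with ones on the superdiagonal and zeros elsewhere. $\mathcal A=\{f(S): f\text{ a complex polynomial}\}$ is the algebra of $n\times n$ upper-triangular Toeplitz matrices. $\|\cdot\|$ is the operator norm on $M_n(\mathbb C)$ induced by the Euclidean norm on $\mathbb C^n$; continuity is with respect to this norm. *)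

theory Defs
  imports "Jordan_Normal_Form.Matrix" "HOL-Computational_Algebra.Polynomial"
begin

definition jordanS :: "nat \<Rightarrow> complex mat" where
  "jordanS n = mat n n (\<lambda>(i,j). if j = Suc i then 1 else 0)"

definition poly_mat :: "nat \<Rightarrow> complex poly \<Rightarrow> complex mat \<Rightarrow> complex mat" where
  "poly_mat n p A = foldr (\<lambda>c M. c \<cdot>\<^sub>m 1\<^sub>m n + A * M) (coeffs p) (0\<^sub>m n n)"

definition toeplitz_alg :: "nat \<Rightarrow> complex mat set" where
  "toeplitz_alg n = {A. \<exists>f. A = poly_mat n f (jordanS n)}"

definition vnorm :: "complex vec \<Rightarrow> real" where
  "vnorm v = sqrt (\<Sum>i<dim_vec v. (cmod (v $ i))\<^sup>2)"

definition opnorm :: "complex mat \<Rightarrow> real" where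
  "opnorm A = Sup {vnorm (A *\<^sub>v v) | v. v \<in> carrier_vec (dim_col A) \<and> vnorm v \<le> 1}"

definition mat_conj :: "complex mat \<Rightarrow> complex mat" where
  "mat_conj A = map_mat cnj A"

definition mat_adj :: "complex mat \<Rightarrow> complex mat" where
  "mat_adj A = transpose_mat (map_mat cnj A)"

definition unitary_mat :: "nat \<Rightarrow> complex mat \<Rightarrow> bool" where
  "unitary_mat n U \<longleftrightarrow> U \<in> carrier_mat n n \<and> U * mat_adj U = 1\<^sub>m n \<and> mat_adj U * U = 1\<^sub>m n"

end

theory Submission
  imports Defs "Jordan_Normal_Form.Determinant" "HOL-Analysis.L2_Norm"
    "HOL-Computational_Algebra.Fundamental_Theorem_Algebra" "HOL-Computational_Algebra.Polynomial_FPS"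
begin

text \<open>
  Let \<open>T = \<phi> S\<close>. Since \<open>\<parallel>T\<parallel> \<le> 1 = \<parallel>T^(n-1)\<parallel>\<close> and \<open>T^n = 0\<close>, a unit vector \<open>x\<close> at which \<open>\<parallel>T^(n-1)\<parallel>\<close> is
  attained has an orthonormal orbit \<open>x, T x, \<dots>, T^(n-1) x\<close>, so \<open>T\<close> is unitarily equivalent to \<open>S\<close>. After
  conjugation \<open>\<phi>\<close> fixes \<open>S\<close>, hence takes values in the commutant of \<open>S\<close>, the Toeplitz algebra, and becomes
  a multiplicative map \<open>F\<close> on power series modulo \<open>X^n\<close>. Norm preservation gives \<open>F a = \<chi> a\<close> with
  \<open>\<bar>\<chi> a\<bar> = \<bar>a\<bar>\<close> on constants. Everything else follows from continuity at the singular elements \<open>b X^j\<close>: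
  letting \<open>m \<rightarrow> \<infinity>\<close> in \<open>1/m + b X^j = (1/m) (1 + m b X^j)\<close> shows first that \<open>\<chi>\<close> is additive, so that it is
  the identity or the conjugation, and then, coefficient by coefficient, that \<open>F\<close> applies \<open>\<chi>\<close> to all
  coefficients: the deviation of the first bad coefficient is a derivation along \<open>\<chi>\<close>, and additive in
  \<open>b\<close> on \<open>1 + b X^j\<close> up to terms already treated, so that the limit forces it to vanish.
\<close>

subsection \<open>Operator norm and unitary equivalence to the Jordan block\<close>

lemma vnorm_eq_L2_set: "vnorm v = L2_set (\<lambda>i. cmod (v $ i)) {..<dim_vec v}"
  by (simp add: vnorm_def L2_set_def)

lemma vnorm_nonneg [simp]: "0 \<le> vnorm v"
  by (simp add: vnorm_eq_L2_set)

lemma vnorm_power2: "(vnorm v)\<^sup>2 = (\<Sum>i<dim_vec v. (cmod (v $ i))\<^sup>2)"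
  unfolding vnorm_def by (simp add: sum_nonneg)

lemma cmod_index_le_vnorm: "i < dim_vec v \<Longrightarrow> cmod (v $ i) \<le> vnorm v"
  unfolding vnorm_eq_L2_set by (rule member_le_L2_set) auto

lemma vnorm_smult: "vnorm (c \<cdot>\<^sub>v v) = cmod c * vnorm v"
proof -
  have "vnorm (c \<cdot>\<^sub>v v) = L2_set (\<lambda>i. cmod c * cmod (v $ i)) {..<dim_vec v}"
    unfolding vnorm_eq_L2_set by (intro L2_set_cong) (auto simp: norm_mult)
  then show ?thesis by (simp add: vnorm_eq_L2_set L2_set_right_distrib)
qed

lemma vnorm_zero [simp]: "vnorm (0\<^sub>v n) = 0"
  by (simp add: vnorm_def)

lemma vnorm_eq_0: "v \<in> carrier_vec n \<Longrightarrow> vnorm v = 0 \<Longrightarrow> v = 0\<^sub>v n"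
  using cmod_index_le_vnorm[of _ v] by (intro eq_vecI) fastforce+

lemma vnorm_unit_vec: "i < n \<Longrightarrow> vnorm (unit_vec n i) = 1"
proof -
  assume "i < n"
  then have "(\<Sum>j<n. (cmod (unit_vec n i $ j))\<^sup>2) = (\<Sum>j<n. if j = i then 1 else 0)"
    by (intro sum.cong) auto
  then show ?thesis using \<open>i < n\<close> by (simp add: vnorm_def)
qed

lemma vnorm_power2_eq_cscalar_prod: "complex_of_real ((vnorm v)\<^sup>2) = v \<bullet>c v"
  unfolding vnorm_power2 scalar_prod_def
  by (simp add: complex_norm_square[symmetric] atLeast0LessThan)

lemma vnorm_add_power2:
  assumes "v \<in> carrier_vec n" "w \<in> carrier_vec n"
  shows "(vnorm (v + w))\<^sup>2 = (vnorm v)\<^sup>2 + (vnorm w)\<^sup>2 + 2 * Re (v \<bullet>c w)"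
proof -
  have "(cmod (a + b))\<^sup>2 = (cmod a)\<^sup>2 + (cmod b)\<^sup>2 + 2 * Re (a * cnj b)" for a b
    unfolding cmod_power2 by (simp add: power2_eq_square algebra_simps)
  then show ?thesis using assms
    by (simp add: vnorm_power2 scalar_prod_def sum.distrib sum_distrib_left atLeast0LessThan)
qed

text \<open>Makes the \<open>Sup\<close> in \<open>opnorm\<close> a genuine supremum. A crude bound
  suffices: on the unit ball every coordinate has modulus at most 1, so the sum of the moduli of all
  entries works.\<close>

lemma bdd_above_opnorm:
  assumes A: "A \<in> carrier_mat n m"
  shows "bdd_above {vnorm (A *\<^sub>v v) | v. v \<in> carrier_vec (dim_col A) \<and> vnorm v \<le> 1}"
proof (rule bdd_aboveI, clarify)
  fix v assume v: "v \<in> carrier_vec (dim_col A)" "vnorm v \<le> 1"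
  have "vnorm (A *\<^sub>v v) \<le> (\<Sum>i<n. cmod ((A *\<^sub>v v) $ i))"
    using A L2_set_le_sum[of "{..<n}" "\<lambda>i. cmod ((A *\<^sub>v v) $ i)"] unfolding vnorm_eq_L2_set by simp
  also have "\<dots> \<le> (\<Sum>i<n. \<Sum>j<m. cmod (A $$ (i, j)))"
  proof (rule sum_mono)
    fix i assume "i \<in> {..<n}"
    then have "(A *\<^sub>v v) $ i = (\<Sum>j<m. A $$ (i, j) * v $ j)"
      using A v by (simp add: scalar_prod_def atLeast0LessThan)
    also have "cmod \<dots> \<le> (\<Sum>j<m. cmod (A $$ (i, j) * v $ j))" by (rule norm_sum)
    also have "\<dots> \<le> (\<Sum>j<m. cmod (A $$ (i, j)))"
    proof (rule sum_mono)
      fix j assume "j \<in> {..<m}"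
      then have "cmod (v $ j) \<le> 1"
        using A v cmod_index_le_vnorm[of j v] by auto
      then show "cmod (A $$ (i, j) * v $ j) \<le> cmod (A $$ (i, j))"
        by (simp add: norm_mult mult_left_le)
    qed
    finally show "cmod ((A *\<^sub>v v) $ i) \<le> (\<Sum>j<m. cmod (A $$ (i, j)))" .
  qed
  finally show "vnorm (A *\<^sub>v v) \<le> (\<Sum>i<n. \<Sum>j<m. cmod (A $$ (i, j)))" .
qed

lemma opnorm_leI:
  assumes "A \<in> carrier_mat n m"
    and "\<And>v. v \<in> carrier_vec m \<Longrightarrow> vnorm v \<le> 1 \<Longrightarrow> vnorm (A *\<^sub>v v) \<le> c"
  shows "opnorm A \<le> c"
  unfolding opnorm_def
proof (rule cSup_least)
  have "0\<^sub>v m \<in> carrier_vec (dim_col A)" "vnorm (0\<^sub>v m) \<le> 1" using assms(1) by auto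
  then show "{vnorm (A *\<^sub>v v) |v. v \<in> carrier_vec (dim_col A) \<and> vnorm v \<le> 1} \<noteq> {}" by blast
qed (use assms in auto)

lemma vnorm_mult_le_opnorm:
  assumes "A \<in> carrier_mat n m" "v \<in> carrier_vec m" "vnorm v \<le> 1"
  shows "vnorm (A *\<^sub>v v) \<le> opnorm A"
  unfolding opnorm_def using assms
  by (intro cSup_upper bdd_above_opnorm) auto

lemma opnorm_nonneg: "A \<in> carrier_mat n m \<Longrightarrow> 0 \<le> opnorm A"
  using order_trans[OF vnorm_nonneg vnorm_mult_le_opnorm[of A n m "0\<^sub>v m"]] by simp

lemma vnorm_mult_mat_vec_le:
  assumes A: "A \<in> carrier_mat n m" and v: "v \<in> carrier_vec m"
  shows "vnorm (A *\<^sub>v v) \<le> opnorm A * vnorm v"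
proof (cases "vnorm v = 0")
  case True
  then have "v = 0\<^sub>v m" using v vnorm_eq_0 by blast
  moreover have "A *\<^sub>v 0\<^sub>v m = 0\<^sub>v n" using A by auto
  ultimately show ?thesis by simp
next
  case False
  define w where "w = complex_of_real (1 / vnorm v) \<cdot>\<^sub>v v"
  have w: "w \<in> carrier_vec m" "vnorm w = 1" using v False by (auto simp: w_def vnorm_smult norm_divide)
  have "A *\<^sub>v w = complex_of_real (1 / vnorm v) \<cdot>\<^sub>v (A *\<^sub>v v)"
    unfolding w_def using A v by (simp add: mult_mat_vec)
  then have "vnorm (A *\<^sub>v v) / vnorm v \<le> opnorm A"
    using vnorm_mult_le_opnorm[OF A w(1)] w(2) by (simp add: vnorm_smult norm_divide)
  then show ?thesis using False vnorm_nonneg[of v] by (simp add: pos_divide_le_eq less_le)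
qed

lemma opnorm_mult_le:
  assumes A: "A \<in> carrier_mat n m" and B: "B \<in> carrier_mat m k"
  shows "opnorm (A * B) \<le> opnorm A * opnorm B"
proof (rule opnorm_leI)
  fix v assume v: "v \<in> carrier_vec k" "vnorm v \<le> 1"
  have "vnorm (A * B *\<^sub>v v) = vnorm (A *\<^sub>v (B *\<^sub>v v))" using A B v by simp
  also have "\<dots> \<le> opnorm A * vnorm (B *\<^sub>v v)"
    using A B v by (intro vnorm_mult_mat_vec_le) auto
  also have "\<dots> \<le> opnorm A * opnorm B"
    using A B v opnorm_nonneg[OF A] by (intro mult_left_mono vnorm_mult_le_opnorm) auto
  finally show "vnorm (A * B *\<^sub>v v) \<le> opnorm A * opnorm B" .
qed (use A B in auto)

lemma opnorm_smult_le:
  assumes A: "A \<in> carrier_mat n m"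
  shows "opnorm (c \<cdot>\<^sub>m A) \<le> cmod c * opnorm A"
proof (rule opnorm_leI)
  fix v assume v: "v \<in> carrier_vec m" "vnorm v \<le> 1"
  have "(c \<cdot>\<^sub>m A) *\<^sub>v v = c \<cdot>\<^sub>v (A *\<^sub>v v)" using A v by auto
  then show "vnorm ((c \<cdot>\<^sub>m A) *\<^sub>v v) \<le> cmod c * opnorm A"
    using vnorm_mult_le_opnorm[OF A v] by (simp add: vnorm_smult mult_left_mono)
qed (use A in auto)

text \<open>For nonzero \<open>c\<close> the reverse inequality comes from applying
  \<open>opnorm_smult_le\<close> to the scalar \<open>1 / c\<close>.\<close>

lemma opnorm_smult:
  assumes A: "A \<in> carrier_mat n m"
  shows "opnorm (c \<cdot>\<^sub>m A) = cmod c * opnorm A"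
proof (cases "c = 0")
  case True
  then show ?thesis using opnorm_smult_le[OF A, of c] opnorm_nonneg[of "c \<cdot>\<^sub>m A" n m] A by simp
next
  case False
  have "(1 / c) \<cdot>\<^sub>m (c \<cdot>\<^sub>m A) = A" using A False by (intro eq_matI) auto
  then have "opnorm A \<le> cmod (1 / c) * opnorm (c \<cdot>\<^sub>m A)"
    using opnorm_smult_le[of "c \<cdot>\<^sub>m A" n m "1 / c"] A by simp
  then show ?thesis using False opnorm_smult_le[OF A, of c] by (simp add: norm_divide field_simps)
qed

lemma mult_mat_unit_vec:
  fixes A :: "'a :: semiring_1 mat"
  assumes "A \<in> carrier_mat n m" "j < m"
  shows "A *\<^sub>v unit_vec m j = col A j"
  using assms by (intro eq_vecI) auto

lemma vnorm_col_le_opnorm: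
  assumes "A \<in> carrier_mat n m" "j < m"
  shows "vnorm (col A j) \<le> opnorm A"
  using vnorm_mult_le_opnorm[OF assms(1), of "unit_vec m j"] assms
  by (simp add: mult_mat_unit_vec vnorm_unit_vec)

lemma cmod_index_le_opnorm:
  assumes "A \<in> carrier_mat n m" "i < n" "j < m"
  shows "cmod (A $$ (i, j)) \<le> opnorm A"
  using cmod_index_le_vnorm[of i "col A j"] vnorm_col_le_opnorm[OF assms(1,3)] assms by simp

lemma opnorm_one_le: "opnorm (1\<^sub>m n) \<le> 1"
  by (rule opnorm_leI) auto

lemma opnorm_zero: "opnorm (0\<^sub>m n m) = 0"
proof -
  have "0 \<cdot>\<^sub>m 0\<^sub>m n m = (0\<^sub>m n m :: complex mat)" by (intro eq_matI) auto
  then show ?thesis using opnorm_smult[of "0\<^sub>m n m" n m 0] by simp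
qed

lemma opnorm_eq_0:
  assumes "A \<in> carrier_mat n m" "opnorm A = 0" shows "A = 0\<^sub>m n m"
  using assms cmod_index_le_opnorm[OF assms(1)] by (intro eq_matI) fastforce+

section \<open>Attainment of the operator norm by compactness\<close>

lemma convergent_subseq_coordinates:
  fixes f :: "nat \<Rightarrow> nat \<Rightarrow> complex"
  assumes "\<And>k i. i < m \<Longrightarrow> cmod (f k i) \<le> B"
  shows "\<exists>r l. strict_mono (r :: nat \<Rightarrow> nat) \<and> (\<forall>i<m. (\<lambda>k. f (r k) i) \<longlonglongrightarrow> l i)"
  using assms
proof (induction m)
  case 0
  show ?case by (intro exI[of _ id]) (auto simp: strict_mono_def)
next
  case (Suc m)
  then obtain r l where r: "strict_mono (r :: nat \<Rightarrow> nat)" "\<And>i. i < m \<Longrightarrow> (\<lambda>k. f (r k) i) \<longlonglongrightarrow> l i"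
    by (metis less_SucI)
  \<comment> \<open>Bolzano-Weierstrass for the new coordinate, along the subsequence already
    chosen; the earlier coordinates keep their limits under the further thinning.\<close>
  obtain s a where s: "strict_mono (s :: nat \<Rightarrow> nat)"
    "\<And>e. e > 0 \<Longrightarrow> \<exists>N. \<forall>k\<ge>N. cmod (f (r (s k)) m - a) < e"
    using Bolzano_Weierstrass_complex_disc[of "\<lambda>k. f (r k) m" B] Suc.prems by blast
  have lim: "(\<lambda>k. f (r (s k)) m) \<longlonglongrightarrow> a"
    using s(2) by (auto simp: LIMSEQ_iff)
  have "(\<lambda>k. f ((r \<circ> s) k) i) \<longlonglongrightarrow> (l(m := a)) i" if "i < Suc m" for i
    using that lim LIMSEQ_subseq_LIMSEQ[OF r(2) s(1), of i] by (cases "i = m") (auto simp: o_def)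
  then show ?case using strict_mono_o[OF r(1) s(1)] by blast
qed

text \<open>A maximizing sequence in the unit ball has a coordinatewise convergent subsequence. Both
  \<open>vnorm v\<close> and \<open>vnorm (A *\<^sub>v v)\<close> are continuous in the coordinates,
  so the limit vector is a maximizer.\<close>

lemma opnorm_attained:
  assumes A: "A \<in> carrier_mat n m"
  obtains x where "x \<in> carrier_vec m" "vnorm x \<le> 1" "vnorm (A *\<^sub>v x) = opnorm A"
proof -
  have "\<exists>v \<in> carrier_vec m. vnorm v \<le> 1 \<and> opnorm A - 1 / Suc k < vnorm (A *\<^sub>v v)" for k
  proof (rule ccontr)
    assume "\<not> ?thesis"
    then have "opnorm A \<le> opnorm A - 1 / Suc k"
      by (intro opnorm_leI[OF A]) force
    then show False by (simp add: field_simps)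
  qed
  then obtain v where v: "\<And>k. v k \<in> carrier_vec m" "\<And>k. vnorm (v k) \<le> 1"
    "\<And>k. opnorm A - 1 / Suc k < vnorm (A *\<^sub>v v k)"
    by metis
  have bound: "cmod (v k $ i) \<le> 1" if "i < m" for i k
    using cmod_index_le_vnorm[of i "v k"] v(1,2)[of k] that by auto
  obtain r l where
    r: "strict_mono (r :: nat \<Rightarrow> nat)" "\<And>i. i < m \<Longrightarrow> (\<lambda>k. v (r k) $ i) \<longlonglongrightarrow> l i"
    using convergent_subseq_coordinates[of m "\<lambda>k i. v k $ i" 1] bound by blast
  define x where "x = vec m l"
  have x: "x \<in> carrier_vec m" by (simp add: x_def)
  have dim: "dim_vec (v k) = m" for k using v(1)[of k] by simp
  have "(\<lambda>k. vnorm (v (r k))) \<longlonglongrightarrow> vnorm x"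
    unfolding vnorm_def dim using r(2) by (auto simp: x_def intro!: tendsto_intros)
  then have le1: "vnorm x \<le> 1" by (rule LIMSEQ_le_const2) (use v(2) in auto)
  have lim: "(\<lambda>k. vnorm (A *\<^sub>v v (r k))) \<longlonglongrightarrow> vnorm (A *\<^sub>v x)"
    unfolding vnorm_def using A r(2) x dim
    by (auto simp: scalar_prod_def x_def intro!: tendsto_intros)
  have "(\<lambda>k. opnorm A - 1 / Suc (r k)) \<longlonglongrightarrow> opnorm A - 0"
    using LIMSEQ_subseq_LIMSEQ[OF LIMSEQ_inverse_real_of_nat r(1)]
    by (intro tendsto_intros) (simp add: o_def inverse_eq_divide)
  from this lim have "opnorm A - 0 \<le> vnorm (A *\<^sub>v x)"
    by (rule LIMSEQ_le) (use v(3) in \<open>auto intro: less_imp_le\<close>)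
  then have "vnorm (A *\<^sub>v x) = opnorm A"
    using vnorm_mult_le_opnorm[OF A x le1] by simp
  then show ?thesis using that x le1 by blast
qed

section \<open>Adjoints and unitary conjugation\<close>

lemma mat_adj_carrier [simp]: "A \<in> carrier_mat n m \<Longrightarrow> mat_adj A \<in> carrier_mat m n"
  by (simp add: mat_adj_def)

lemma cscalar_prod_mat_adj:
  assumes A: "A \<in> carrier_mat n m" and v: "v \<in> carrier_vec m" and w: "w \<in> carrier_vec n"
  shows "(A *\<^sub>v v) \<bullet>c w = v \<bullet>c (mat_adj A *\<^sub>v w)"
proof -
  have "(A *\<^sub>v v) \<bullet>c w = (\<Sum>i<n. \<Sum>j<m. A $$ (i, j) * v $ j * cnj (w $ i))"
    using assms by (simp add: scalar_prod_def atLeast0LessThan sum_distrib_right)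
  also have "\<dots> = (\<Sum>j<m. \<Sum>i<n. A $$ (i, j) * v $ j * cnj (w $ i))" by (rule sum.swap)
  also have "\<dots> = v \<bullet>c (mat_adj A *\<^sub>v w)"
    using assms by (simp add: scalar_prod_def atLeast0LessThan sum_distrib_left mat_adj_def mult_ac)
  finally show ?thesis .
qed

lemma mat_adj_mat_adj [simp]: "mat_adj (mat_adj A) = A"
  by (intro eq_matI) (auto simp: mat_adj_def)

lemma unitary_mat_adj: "unitary_mat n U \<Longrightarrow> unitary_mat n (mat_adj U)"
  by (auto simp: unitary_mat_def)

lemma opnorm_unitary_le:
  assumes U: "unitary_mat n U" shows "opnorm U \<le> 1"
proof -
  have U': "U \<in> carrier_mat n n" "mat_adj U * U = 1\<^sub>m n" using U by (auto simp: unitary_mat_def)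
  have "vnorm (U *\<^sub>v v) = vnorm v" if v: "v \<in> carrier_vec n" for v
  proof -
    have "mat_adj U *\<^sub>v (U *\<^sub>v v) = v"
      using assoc_mult_mat_vec[of "mat_adj U" n n U n v] U' v by simp
    then have "(U *\<^sub>v v) \<bullet>c (U *\<^sub>v v) = v \<bullet>c v"
      using cscalar_prod_mat_adj[OF U'(1) v, of "U *\<^sub>v v"] U' v by simp
    then have "(vnorm (U *\<^sub>v v))\<^sup>2 = (vnorm v)\<^sup>2"
      unfolding vnorm_power2_eq_cscalar_prod[symmetric] by (simp only: of_real_eq_iff)
    then show ?thesis by simp
  qed
  then show ?thesis by (intro opnorm_leI[OF U'(1)]) simp
qed

lemma opnorm_unitary_conj_le:
  assumes U: "unitary_mat n U" and A: "A \<in> carrier_mat n n"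
  shows "opnorm (U * A * mat_adj U) \<le> opnorm A"
proof -
  have c: "U \<in> carrier_mat n n" using U by (simp add: unitary_mat_def)
  have "opnorm (U * A * mat_adj U) \<le> opnorm U * opnorm A * opnorm (mat_adj U)"
    using opnorm_mult_le[of "U * A" n n "mat_adj U" n] opnorm_mult_le[of U n n A n] c A
      opnorm_nonneg[of "mat_adj U" n n] by (auto intro: order_trans mult_right_mono)
  also have "\<dots> \<le> 1 * opnorm A * 1"
    using opnorm_unitary_le[OF U] opnorm_unitary_le[OF unitary_mat_adj[OF U]] opnorm_nonneg[OF A]
      opnorm_nonneg[OF c] opnorm_nonneg[OF mat_adj_carrier[OF c]]
    by (intro mult_mono) auto
  finally show ?thesis by simp
qed

lemma unitary_conj_cancel:
  assumes U: "unitary_mat n U" and A: "A \<in> carrier_mat n n"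
  shows "U * (mat_adj U * A * U) * mat_adj U = A"
proof -
  have c: "U \<in> carrier_mat n n" "mat_adj U \<in> carrier_mat n n" "U * mat_adj U = 1\<^sub>m n"
    using U by (auto simp: unitary_mat_def)
  have "U * (mat_adj U * A * U) * mat_adj U = (U * mat_adj U) * A * (U * mat_adj U)"
    using c(1,2) A by (simp add: assoc_mult_mat[of _ n n _ n _ n] mult_carrier_mat[of _ n n _ n])
  then show ?thesis using c(3) A by simp
qed

text \<open>Conjugation by \<open>U\<close> undoes conjugation by \<open>mat_adj U\<close>, and
  neither increases the norm.\<close>

lemma opnorm_unitary_conj:
  assumes U: "unitary_mat n U" and A: "A \<in> carrier_mat n n"
  shows "opnorm (mat_adj U * A * U) = opnorm A"
proof (rule antisym)
  have c: "U \<in> carrier_mat n n" using U by (simp add: unitary_mat_def)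
  show "opnorm (mat_adj U * A * U) \<le> opnorm A"
    using opnorm_unitary_conj_le[OF unitary_mat_adj[OF U] A] by simp
  show "opnorm A \<le> opnorm (mat_adj U * A * U)"
    using opnorm_unitary_conj_le[OF U, of "mat_adj U * A * U"] unitary_conj_cancel[OF U A] A c
    by (simp add: mult_carrier_mat[of _ n n _ n])
qed

section \<open>Contractions with an orthonormal orbit\<close>

text \<open>First variation of \<open>\<parallel>v + t w\<parallel>\<^sup>2 - \<parallel>A (v + t w)\<parallel>\<^sup>2 \<ge> 0\<close> at \<open>t = 0\<close>, where it attains its minimum \<open>0\<close>.\<close>
lemma cscalar_prod_contraction_eq:
  assumes A: "A \<in> carrier_mat n n" and contr: "\<And>u. u \<in> carrier_vec n \<Longrightarrow> vnorm (A *\<^sub>v u) \<le> vnorm u"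
    and v: "v \<in> carrier_vec n" and w: "w \<in> carrier_vec n" and eq: "vnorm (A *\<^sub>v v) = vnorm v"
  shows "(A *\<^sub>v v) \<bullet>c (A *\<^sub>v w) = v \<bullet>c w"
proof (rule ccontr)
  assume neq: "\<not> ?thesis"
  define d where "d = (A *\<^sub>v v) \<bullet>c (A *\<^sub>v w) - v \<bullet>c w"
  define C where "C = (vnorm w)\<^sup>2"
  have d: "cmod d > 0" using neq by (simp add: d_def)
  have key: "2 * Re (cnj t * d) \<le> (cmod t)\<^sup>2 * C" for t
  proof -
    have tw: "t \<cdot>\<^sub>v w \<in> carrier_vec n" using w by simp
    have Av: "A *\<^sub>v v \<in> carrier_vec n" and Aw: "A *\<^sub>v w \<in> carrier_vec n" using A v w by auto
    have "A *\<^sub>v (v + t \<cdot>\<^sub>v w) = A *\<^sub>v v + t \<cdot>\<^sub>v (A *\<^sub>v w)"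
      using A v w by (simp add: mult_add_distrib_mat_vec mult_mat_vec)
    then have "(vnorm (A *\<^sub>v v + t \<cdot>\<^sub>v (A *\<^sub>v w)))\<^sup>2 \<le> (vnorm (v + t \<cdot>\<^sub>v w))\<^sup>2"
      using contr[of "v + t \<cdot>\<^sub>v w"] v w by (simp add: power_mono)
    moreover have "x \<bullet>c (t \<cdot>\<^sub>v y) = cnj t * (x \<bullet>c y)" if "x \<in> carrier_vec n" "y \<in> carrier_vec n" for x y
      using that by (simp add: conjugate_smult_vec)
    ultimately have "2 * Re (cnj t * ((A *\<^sub>v v) \<bullet>c (A *\<^sub>v w))) + (vnorm (t \<cdot>\<^sub>v (A *\<^sub>v w)))\<^sup>2
        \<le> 2 * Re (cnj t * (v \<bullet>c w)) + (vnorm (t \<cdot>\<^sub>v w))\<^sup>2"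
      using v w Av Aw tw eq by (simp add: vnorm_add_power2)
    moreover have "(vnorm (t \<cdot>\<^sub>v w))\<^sup>2 = (cmod t)\<^sup>2 * C"
      by (simp add: vnorm_smult C_def power_mult_distrib)
    moreover have "0 \<le> (vnorm (t \<cdot>\<^sub>v (A *\<^sub>v w)))\<^sup>2" by simp
    ultimately show ?thesis unfolding d_def right_diff_distrib minus_complex.sel by linarith
  qed
  \<comment> \<open>With \<open>t = s * d\<close> the linear term of \<open>key\<close> is
    \<open>2 * s * \<bar>d\<bar>^2\<close>, while the quadratic term is
    \<open>s^2 * \<bar>d\<bar>^2 * C\<close>. The choice of \<open>s\<close> gives
    \<open>s * C < 1\<close>, so the quadratic term cannot dominate.\<close>
  define s where "s = 1 / (C + 1)"
  have C: "C \<ge> 0" by (simp add: C_def)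
  have s: "s > 0" "s * C < 1" using C by (auto simp: s_def)
  have "Re (cnj (complex_of_real s * d) * d) = s * (cmod d)\<^sup>2"
    unfolding cmod_power2 by (simp add: power2_eq_square algebra_simps)
  then have "2 * (s * (cmod d)\<^sup>2) \<le> s * (cmod d)\<^sup>2 * (s * C)"
    using key[of "complex_of_real s * d"] by (simp add: norm_mult power_mult_distrib power2_eq_square mult_ac)
  also have "\<dots> \<le> s * (cmod d)\<^sup>2 * 1" using s by (intro mult_left_mono) auto
  finally show False using s d by simp
qed

lemma pow_mat_mult_vec_Suc:
  assumes "A \<in> carrier_mat n n" "x \<in> carrier_vec n"
  shows "(A ^\<^sub>m Suc k) *\<^sub>v x = A *\<^sub>v ((A ^\<^sub>m k) *\<^sub>v x)"
proof -
  have "A ^\<^sub>m Suc k = A * A ^\<^sub>m k"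
  proof (induction k)
    case (Suc k)
    have "A ^\<^sub>m Suc (Suc k) = A ^\<^sub>m Suc k * A" by simp
    also have "\<dots> = A * A ^\<^sub>m k * A" by (simp only: Suc.IH)
    also have "\<dots> = A * (A ^\<^sub>m k * A)"
      using assms(1) by (intro assoc_mult_mat[of _ n n _ n _ n]) auto
    finally show ?case by simp
  qed (use assms(1) in simp)
  then show ?thesis using assms assoc_mult_mat_vec[of A n n "A ^\<^sub>m k" n x] by simp
qed

text \<open>The orbit of a maximizer of \<open>T ^\<^sub>m (n - 1)\<close> keeps norm 1 up to index
  \<open>n - 1\<close>, so the contraction \<open>T\<close> loses no norm there and
  \<open>cscalar_prod_contraction_eq\<close> applies along it. Pushing two orbit vectors forward
  together until the later one becomes 0 shows that they are orthogonal.\<close>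

lemma unitary_equiv_jordanS:
  assumes T: "T \<in> carrier_mat n n" and n: "n > 0" and le: "opnorm T \<le> 1"
    and nil: "T ^\<^sub>m n = 0\<^sub>m n n" and ge: "opnorm (T ^\<^sub>m (n - 1)) \<ge> 1"
  obtains U where "unitary_mat n U" "T * U = U * jordanS n"
proof -
  obtain x where x0: "x \<in> carrier_vec n" "vnorm x \<le> 1"
      "vnorm (T ^\<^sub>m (n - 1) *\<^sub>v x) = opnorm (T ^\<^sub>m (n - 1))"
    by (rule opnorm_attained[OF pow_carrier_mat[OF T]])
  then have x: "x \<in> carrier_vec n" "vnorm x \<le> 1" "vnorm (T ^\<^sub>m (n - 1) *\<^sub>v x) \<ge> 1"
    using ge by simp_all
  define y where "y k = T ^\<^sub>m k *\<^sub>v x" for k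
  have y: "y k \<in> carrier_vec n" for k
    unfolding y_def by (rule mult_mat_vec_carrier[OF pow_carrier_mat[OF T] x(1)])
  have ySuc: "y (Suc k) = T *\<^sub>v y k" for k
    unfolding y_def by (rule pow_mat_mult_vec_Suc[OF T x(1)])
  have contr: "vnorm (T *\<^sub>v v) \<le> vnorm v" if "v \<in> carrier_vec n" for v
    using vnorm_mult_mat_vec_le[OF T that] mult_right_mono[OF le vnorm_nonneg[of v]] by simp
  have dec: "vnorm (y (k + i)) \<le> vnorm (y k)" for k i
  proof (induction i)
    case (Suc i)
    have "vnorm (y (k + Suc i)) \<le> vnorm (y (k + i))"
      using contr[OF y, of "k + i"] by (simp add: ySuc)
    then show ?case using Suc.IH by simp
  qed simp
  \<comment> \<open>The norms decrease along the orbit, starting from at most 1 and still at least 1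
    at index \<open>n - 1\<close>.\<close>
  have y1: "vnorm (y k) = 1" if "k < n" for k
  proof (rule antisym)
    show "vnorm (y k) \<le> 1" using dec[of 0 k] x(1,2) T by (simp add: y_def)
    show "1 \<le> vnorm (y k)" using dec[of k "n - 1 - k"] that x(3) by (simp add: y_def)
  qed
  have yn: "y n = 0\<^sub>v n" unfolding y_def nil using x(1) by (intro eq_vecI) auto
  \<comment> \<open>The gap \<open>Suc d\<close> stays fixed and \<open>i\<close> descends from the
    position where the second vector is \<open>y n = 0\<close>.\<close>
  have orth: "y i \<bullet>c y (i + Suc d) = 0" if "i + Suc d \<le> n" for i d
    using that
  proof (induction "n - (i + Suc d)" arbitrary: i)
    case 0
    then have "i + Suc d = n" by simp
    then show ?case using y[of i] by (simp add: yn del: add_Suc_right)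
  next
    case (Suc m)
    have eq: "vnorm (T *\<^sub>v y i) = vnorm (y i)"
      using Suc(2,3) y1[of i] y1[of "Suc i"] unfolding ySuc by linarith
    have "y (Suc i) \<bullet>c y (Suc (i + Suc d)) = y i \<bullet>c y (i + Suc d)"
      unfolding ySuc by (rule cscalar_prod_contraction_eq[OF T _ y y eq]) (rule contr)
    moreover have "y (Suc i) \<bullet>c y (Suc i + Suc d) = 0" using Suc(2,3) by (intro Suc(1)) auto
    ultimately show ?case by (simp only: add_Suc)
  qed
  have orth': "y i \<bullet>c y j = (if i = j then 1 else 0)" if ij: "i < n" "j < n" for i j
  proof -
    consider "i = j" | "i < j" | "j < i" by linarith
    then show ?thesis
    proof cases
      case 1
      then show ?thesis using vnorm_power2_eq_cscalar_prod[of "y i"] y1[OF ij(1)] by simp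
    next
      case 2
      then show ?thesis using orth[of i "j - Suc i"] ij by simp
    next
      case 3
      then have "y j \<bullet>c y i = 0" using orth[of j "i - Suc j"] ij by simp
      moreover have "conjugate (y j \<bullet>c y i) = conjugate (y j) \<bullet> y i"
        using conjugate_sprod_vec[OF y[of j] carrier_vec_conjugate[OF y[of i]]] by simp
      ultimately have "y i \<bullet>c y j = 0"
        unfolding conjugate_vec_sprod_comm[OF y[of i] y[of j]] by simp
      then show ?thesis using 3 by simp
    qed
  qed
  \<comment> \<open>The orbit is listed backwards because \<open>jordanS\<close> lowers the index of
    a unit vector, whereas \<open>T\<close> raises the index of \<open>y\<close>.\<close>
  define U where "U = mat n n (\<lambda>(i, j). y (n - 1 - j) $ i)"
  have U: "U \<in> carrier_mat n n" by (simp add: U_def)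
  have colU: "col U j = y (n - 1 - j)" if "j < n" for j
    using that y[of "n - 1 - j"] by (intro eq_vecI) (auto simp: U_def)
  have UU: "mat_adj U * U = 1\<^sub>m n"
  proof (rule eq_matI)
    fix i j assume "i < dim_row (1\<^sub>m n :: complex mat)" "j < dim_col (1\<^sub>m n :: complex mat)"
    then have ij: "i < n" "j < n" by auto
    have "row (mat_adj U) i = conjugate (col U i)"
      using ij U by (intro eq_vecI) (auto simp: mat_adj_def)
    then have "(mat_adj U * U) $$ (i, j) = conjugate (y (n - 1 - i)) \<bullet> y (n - 1 - j)"
      using ij U colU by (simp add: mat_adj_def)
    also have "\<dots> = y (n - 1 - j) \<bullet>c y (n - 1 - i)"
      using y by (intro conjugate_vec_sprod_comm[symmetric])
    also have "\<dots> = 1\<^sub>m n $$ (i, j)" using ij by (subst orth') auto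
    finally show "(mat_adj U * U) $$ (i, j) = 1\<^sub>m n $$ (i, j)" .
  qed (use U in \<open>auto simp: mat_adj_def\<close>)
  have "unitary_mat n U"
    using U UU mat_mult_left_right_inverse[OF mat_adj_carrier[OF U] U UU] by (simp add: unitary_mat_def)
  moreover have "T * U = U * jordanS n"
  proof (rule eq_matI)
    fix i j assume "i < dim_row (U * jordanS n)" "j < dim_col (U * jordanS n)"
    then have ij: "i < n" "j < n" using U by (auto simp: jordanS_def)
    have "(T * U) $$ (i, j) = (T *\<^sub>v y (n - 1 - j)) $ i"
      using ij T U by (simp add: colU)
    also have "\<dots> = y (n - j) $ i"
      using ij ySuc[of "n - 1 - j"] by (simp add: Suc_diff_Suc)
    \<comment> \<open>Column 0 holds the last orbit vector \<open>y (n - 1)\<close>, which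
      \<open>T\<close> sends to \<open>y n = 0\<close>; this matches the zero first column of
      \<open>jordanS\<close>.\<close>
    also have "\<dots> = (if j = 0 then 0 else y (n - 1 - (j - 1)) $ i)"
      using ij yn by auto
    also have "\<dots> = (\<Sum>l<n. if j = Suc l then U $$ (i, l) else 0)"
      using ij by (cases j) (auto simp: U_def)
    also have "\<dots> = (\<Sum>l<n. U $$ (i, l) * (if j = Suc l then 1 else 0))"
      by (intro sum.cong) auto
    also have "\<dots> = (U * jordanS n) $$ (i, j)"
      using ij U by (simp add: jordanS_def scalar_prod_def atLeast0LessThan)
    finally show "(T * U) $$ (i, j) = (U * jordanS n) $$ (i, j)" .
  qed (use T U in \<open>auto simp: jordanS_def\<close>)
  ultimately show ?thesis using that by blast
qed

section \<open>Toeplitz matrices as power series modulo \<open>X^n\<close>\<close>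

text \<open>Power series serve as representatives in place of polynomials because a series with
  nonzero constant term has an inverse. Only the coefficients below \<open>n\<close> enter the
  matrix.\<close>

definition toeplitz_mat :: "nat \<Rightarrow> complex fps \<Rightarrow> complex mat" where
  "toeplitz_mat n f = mat n n (\<lambda>(i, j). if i \<le> j then fps_nth f (j - i) else 0)"

lemma toeplitz_mat_carrier [simp]: "toeplitz_mat n f \<in> carrier_mat n n"
  by (simp add: toeplitz_mat_def)

lemma toeplitz_mat_dim [simp]: "dim_row (toeplitz_mat n f) = n" "dim_col (toeplitz_mat n f) = n"
  by (simp_all add: toeplitz_mat_def)

lemma toeplitz_mat_index:
  "i < n \<Longrightarrow> j < n \<Longrightarrow> toeplitz_mat n f $$ (i, j) = (if i \<le> j then fps_nth f (j - i) else 0)"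
  by (simp add: toeplitz_mat_def)

lemma toeplitz_mat_cong:
  "(\<And>i. i < n \<Longrightarrow> fps_nth f i = fps_nth g i) \<Longrightarrow> toeplitz_mat n f = toeplitz_mat n g"
  by (intro eq_matI) (auto simp: toeplitz_mat_index)

lemma toeplitz_mat_eqD:
  "toeplitz_mat n f = toeplitz_mat n g \<Longrightarrow> i < n \<Longrightarrow> fps_nth f i = fps_nth g i"
  using toeplitz_mat_index[of 0 n i f] toeplitz_mat_index[of 0 n i g] by simp

lemma toeplitz_mat_add: "toeplitz_mat n (f + g) = toeplitz_mat n f + toeplitz_mat n g"
  by (intro eq_matI) (auto simp: toeplitz_mat_index)

lemma toeplitz_mat_const: "toeplitz_mat n (fps_const c) = c \<cdot>\<^sub>m 1\<^sub>m n"
  by (intro eq_matI) (auto simp: toeplitz_mat_index)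

lemma toeplitz_mat_0: "toeplitz_mat n 0 = 0\<^sub>m n n"
  by (intro eq_matI) (auto simp: toeplitz_mat_index)

lemma toeplitz_mat_X: "toeplitz_mat n fps_X = jordanS n"
  by (intro eq_matI) (auto simp: toeplitz_mat_index jordanS_def)

text \<open>Triangularity restricts the summation index to the range from \<open>i\<close> to
  \<open>j\<close>; shifting it by \<open>i\<close> leaves the Cauchy product at degree
  \<open>j - i\<close>.\<close>

lemma toeplitz_mat_mult: "toeplitz_mat n (f * g) = toeplitz_mat n f * toeplitz_mat n g"
proof (rule eq_matI)
  fix i j assume "i < dim_row (toeplitz_mat n f * toeplitz_mat n g)"
    "j < dim_col (toeplitz_mat n f * toeplitz_mat n g)"
  then have ij: "i < n" "j < n" by auto
  have "(toeplitz_mat n f * toeplitz_mat n g) $$ (i, j)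
      = (\<Sum>l<n. (if i \<le> l then fps_nth f (l - i) else 0) * (if l \<le> j then fps_nth g (j - l) else 0))"
    using ij by (simp add: scalar_prod_def atLeast0LessThan toeplitz_mat_index)
  also have "\<dots> = (\<Sum>l\<in>{i..j}. fps_nth f (l - i) * fps_nth g (j - l))"
    using ij by (intro sum.mono_neutral_cong_right) auto
  also have "\<dots> = toeplitz_mat n (f * g) $$ (i, j)"
  proof (cases "i \<le> j")
    case True
    have "(\<Sum>l\<in>{i..j}. fps_nth f (l - i) * fps_nth g (j - l))
        = (\<Sum>l=0..j - i. fps_nth f l * fps_nth g (j - i - l))"
      using True by (intro sum.reindex_bij_witness[of _ "\<lambda>l. l + i" "\<lambda>l. l - i"]) auto
    then show ?thesis using ij True by (simp add: toeplitz_mat_index fps_mult_nth)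
  qed (use ij in \<open>auto simp: toeplitz_mat_index\<close>)
  finally show "toeplitz_mat n (f * g) $$ (i, j) = (toeplitz_mat n f * toeplitz_mat n g) $$ (i, j)" ..
qed auto

text \<open>\<open>poly_mat\<close> is a Horner scheme, so it unfolds along \<open>pCons\<close>,
  and its recursion is that of a power series with multiplication by \<open>fps_X\<close> in the
  role of \<open>jordanS\<close>.\<close>

lemma poly_mat_jordanS: "poly_mat n p (jordanS n) = toeplitz_mat n (fps_of_poly p)"
proof (induction p)
  case 0
  show ?case by (simp add: poly_mat_def toeplitz_mat_0)
next
  case (pCons c p)
  have "poly_mat n (pCons c p) (jordanS n) = c \<cdot>\<^sub>m 1\<^sub>m n + jordanS n * poly_mat n p (jordanS n)"
    using pCons.hyps by (auto simp: poly_mat_def cCons_def)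
  also have "\<dots> = toeplitz_mat n (fps_const c + fps_X * fps_of_poly p)"
    by (simp add: pCons.IH toeplitz_mat_add toeplitz_mat_const toeplitz_mat_mult toeplitz_mat_X)
  finally show ?case by (simp add: fps_of_poly_pCons mult.commute)
qed

lemma toeplitz_alg_eq_range: "toeplitz_alg n = range (toeplitz_mat n)"
proof
  show "toeplitz_alg n \<subseteq> range (toeplitz_mat n)"
    by (auto simp: toeplitz_alg_def poly_mat_jordanS)
  show "range (toeplitz_mat n) \<subseteq> toeplitz_alg n"
  proof clarify
    fix f :: "complex fps"
    \<comment> \<open>The truncation of \<open>f\<close> below degree \<open>n\<close>.\<close>
    define p where "p = (\<Sum>i<n. monom (fps_nth f i) i)"
    have "coeff p i = fps_nth f i" if "i < n" for i
      using that by (simp add: p_def coeff_sum)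
    then have "toeplitz_mat n f = poly_mat n p (jordanS n)"
      unfolding poly_mat_jordanS by (intro toeplitz_mat_cong) simp
    then show "toeplitz_mat n f \<in> toeplitz_alg n" by (auto simp: toeplitz_alg_def)
  qed
qed

text \<open>Comparing entries of the two products lets each entry slide up its diagonal to row 0, or
  to column 0 below the main diagonal, where it is forced to be 0.\<close>

lemma commute_jordanS_imp_toeplitz:
  assumes M: "M \<in> carrier_mat n n" and comm: "M * jordanS n = jordanS n * M"
  shows "M = toeplitz_mat n (Abs_fps (\<lambda>k. M $$ (0, k)))"
proof -
  have left: "(jordanS n * M) $$ (i, j) = (if Suc i < n then M $$ (Suc i, j) else 0)"
    if "i < n" "j < n" for i j
  proof -
    have "(jordanS n * M) $$ (i, j) = (\<Sum>l<n. (if l = Suc i then 1 else 0) * M $$ (l, j))"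
      using that M by (simp add: jordanS_def scalar_prod_def atLeast0LessThan)
    also have "\<dots> = (\<Sum>l<n. if l = Suc i then M $$ (l, j) else 0)"
      by (intro sum.cong) auto
    finally have "(jordanS n * M) $$ (i, j) = (\<Sum>l<n. if l = Suc i then M $$ (l, j) else 0)" .
    then show ?thesis by simp
  qed
  have right: "(M * jordanS n) $$ (i, j) = (if j = 0 then 0 else M $$ (i, j - 1))"
    if "i < n" "j < n" for i j
  proof -
    have "(M * jordanS n) $$ (i, j) = (\<Sum>l<n. M $$ (i, l) * (if j = Suc l then 1 else 0))"
      using that M by (simp add: jordanS_def scalar_prod_def atLeast0LessThan)
    also have "\<dots> = (\<Sum>l<n. if j = Suc l then M $$ (i, l) else 0)"
      by (intro sum.cong) auto
    finally have "(M * jordanS n) $$ (i, j) = (\<Sum>l<n. if j = Suc l then M $$ (i, l) else 0)" .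
    then show ?thesis using that by (cases j) auto
  qed
  have step: "M $$ (Suc i, j) = (if j = 0 then 0 else M $$ (i, j - 1))" if "Suc i < n" "j < n" for i j
    using that left[of i j] right[of i j] comm by simp
  have entry: "M $$ (i, j) = (if i \<le> j then M $$ (0, j - i) else 0)" if "i < n" "j < n" for i j
    using that
  proof (induction i arbitrary: j)
    case (Suc i)
    then show ?case using step[of i j] by (cases j) auto
  qed simp
  show ?thesis
  proof (rule eq_matI)
    fix i j assume "i < dim_row (toeplitz_mat n (Abs_fps (\<lambda>k. M $$ (0, k))))"
      "j < dim_col (toeplitz_mat n (Abs_fps (\<lambda>k. M $$ (0, k))))"
    then have ij: "i < n" "j < n" by simp_all
    show "M $$ (i, j) = toeplitz_mat n (Abs_fps (\<lambda>k. M $$ (0, k))) $$ (i, j)"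
      unfolding entry[OF ij] toeplitz_mat_index[OF ij] fps_nth_Abs_fps ..
  qed (use M in auto)
qed

lemma opnorm_toeplitz_const: "opnorm (toeplitz_mat n (fps_const c)) \<le> cmod c"
  unfolding toeplitz_mat_const
  using opnorm_smult[of "1\<^sub>m n" n n c] mult_left_mono[OF opnorm_one_le[of n], of "cmod c"] by simp

text \<open>The block drops coordinate 0 and shifts the others, so the squared norm only loses a
  term.\<close>

lemma opnorm_jordanS_le: "opnorm (jordanS n) \<le> 1"
proof (rule opnorm_leI)
  show "jordanS n \<in> carrier_mat n n" by (simp add: jordanS_def)
  fix v :: "complex vec" assume v: "v \<in> carrier_vec n" "vnorm v \<le> 1"
  have Sv: "(jordanS n *\<^sub>v v) $ i = (if Suc i < n then v $ Suc i else 0)" if "i < n" for i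
  proof -
    have "(jordanS n *\<^sub>v v) $ i = (\<Sum>l<n. (if l = Suc i then 1 else 0) * v $ l)"
      using that v by (simp add: jordanS_def scalar_prod_def atLeast0LessThan)
    also have "\<dots> = (\<Sum>l<n. if l = Suc i then v $ l else 0)"
      by (intro sum.cong) auto
    finally have "(jordanS n *\<^sub>v v) $ i = (\<Sum>l<n. if l = Suc i then v $ l else 0)" .
    then show ?thesis by simp
  qed
  have "(vnorm (jordanS n *\<^sub>v v))\<^sup>2 = (\<Sum>i<n. (cmod ((jordanS n *\<^sub>v v) $ i))\<^sup>2)"
    unfolding vnorm_power2 by (simp add: jordanS_def)
  also have "\<dots> = (\<Sum>i\<in>{i. Suc i < n}. (cmod (v $ Suc i))\<^sup>2)"
    by (intro sum.mono_neutral_cong_right) (auto simp: Sv)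
  also have "\<dots> = (\<Sum>i\<in>Suc ` {i. Suc i < n}. (cmod (v $ i))\<^sup>2)"
    by (simp add: sum.reindex)
  also have "\<dots> \<le> (\<Sum>i<n. (cmod (v $ i))\<^sup>2)"
    by (intro sum_mono2) auto
  also have "\<dots> = (vnorm v)\<^sup>2" using v unfolding vnorm_power2 by simp
  finally have "vnorm (jordanS n *\<^sub>v v) \<le> vnorm v" by (rule power2_le_imp_le) simp
  then show "vnorm (jordanS n *\<^sub>v v) \<le> 1" using v by simp
qed

text \<open>The corner entry in row 0 and column \<open>n - 1\<close> is 1.\<close>

lemma opnorm_toeplitz_X_power_ge:
  assumes "n > 0" shows "opnorm (toeplitz_mat n (fps_X ^ (n - 1))) \<ge> 1"
  using cmod_index_le_opnorm[OF toeplitz_mat_carrier, of 0 n "n - 1" "fps_X ^ (n - 1)"] assms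
  by (simp add: toeplitz_mat_index)

subsection \<open>Multiplicative maps on truncated power series\<close>

no_notation vec_index (infixl \<open>$\<close> 100)
unbundle fps_syntax

text \<open>The difference of \<open>\<bar>z + 1\<bar>^2\<close> and \<open>\<bar>z\<bar>^2\<close>
  determines \<open>Re z\<close>, so real parts are preserved. The image of \<open>\<i>\<close> is a
  square root of -1, and its sign decides the imaginary parts through
  \<open>Re (\<i> * z) = - Im z\<close>.\<close>

lemma isometric_ring_endo_complex:
  fixes \<chi> :: "complex \<Rightarrow> complex"
  assumes add: "\<And>a b. \<chi> (a + b) = \<chi> a + \<chi> b" and mult: "\<And>a b. \<chi> (a * b) = \<chi> a * \<chi> b"
    and one: "\<chi> 1 = 1" and norm: "\<And>a. cmod (\<chi> a) = cmod a"
  shows "\<chi> = (\<lambda>z. z) \<or> \<chi> = cnj"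
proof -
  have zero: "\<chi> 0 = 0" using norm[of 0] by simp
  have neg: "\<chi> (- a) = - \<chi> a" for a
    using add[of a "- a"] zero by (simp add: add_eq_0_iff)
  have re: "Re (\<chi> z) = Re z" for z
  proof -
    have "(cmod (\<chi> z + 1))\<^sup>2 = (cmod (z + 1))\<^sup>2" "(cmod (\<chi> z))\<^sup>2 = (cmod z)\<^sup>2"
      using norm[of "z + 1"] norm[of z] by (simp_all add: add one)
    then show ?thesis unfolding cmod_power2 by (simp add: power2_eq_square algebra_simps)
  qed
  have "\<chi> \<i> * \<chi> \<i> = \<i> * \<i>" using mult[of \<i> \<i>] by (simp add: neg one)
  then have "\<chi> \<i> = \<i> \<or> \<chi> \<i> = - \<i>" by (metis square_eq_iff)
  then show ?thesis
  proof
    assume i: "\<chi> \<i> = \<i>"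
    have "Im (\<chi> z) = Im z" for z
      using re[of "\<i> * z"] by (simp add: mult i)
    then show ?thesis using re by (auto intro!: complex_eqI)
  next
    assume i: "\<chi> \<i> = - \<i>"
    have "Im (\<chi> z) = - Im z" for z
      using re[of "\<i> * z"] by (simp add: mult i)
    then have "\<chi> = cnj" using re by (auto intro!: complex_eqI)
    then show ?thesis ..
  qed
qed

text \<open>A multiplicative map on power series modulo \<open>X^n\<close>, written on
  representatives: \<open>F_cong\<close> makes it well defined, and values are compared only below
  degree \<open>n\<close>. Continuity enters as the limits \<open>F_lim\<close>.\<close>

locale truncated_endo =
  fixes n :: nat and F :: "complex fps \<Rightarrow> complex fps" and \<chi> :: "complex \<Rightarrow> complex"
  assumes n_gt: "n > 1"
    and F_cong: "(\<And>i. i < n \<Longrightarrow> f $ i = g $ i) \<Longrightarrow> F f = F g"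
    and F_mult: "i < n \<Longrightarrow> F (f * g) $ i = (F f * F g) $ i"
    and F_X: "i < n \<Longrightarrow> F fps_X $ i = fps_X $ i"
    and F_const: "i < n \<Longrightarrow> F (fps_const a) $ i = (if i = 0 then \<chi> a else 0)"
    and norm_\<chi>: "cmod (\<chi> a) = cmod a"
    and F_lim: "i < n \<Longrightarrow> (\<lambda>m. F (fps_const (1 / of_nat (Suc m)) + fps_const b * fps_X ^ j) $ i)
                  \<longlonglongrightarrow> F (fps_const b * fps_X ^ j) $ i"
begin

lemma \<chi>_mult: "\<chi> (a * b) = \<chi> a * \<chi> b"
  using F_mult[of 0 "fps_const a" "fps_const b"] n_gt F_const[of 0] by simp

lemma \<chi>_1: "\<chi> 1 = 1"
proof -
  have "\<chi> 1 \<noteq> 0" using norm_\<chi>[of 1] by auto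
  then show ?thesis using \<chi>_mult[of 1 1] by simp
qed

lemma \<chi>_0: "\<chi> 0 = 0"
  using norm_\<chi>[of 0] by simp

lemma F_1: "i < n \<Longrightarrow> F 1 $ i = (if i = 0 then 1 else 0)"
  using F_const[of i 1] \<chi>_1 by simp

lemma F_X_mult: 
  assumes "i < n" shows "F (fps_X * f) $ i = (if i = 0 then 0 else F f $ (i - 1))"
proof -
  have "F (fps_X * f) $ i = (\<Sum>l=0..i. F fps_X $ l * F f $ (i - l))"
    using F_mult[OF assms] by (simp add: fps_mult_nth)
  also have "\<dots> = (\<Sum>l=0..i. fps_X $ l * F f $ (i - l))"
    using assms by (intro sum.cong) (auto simp: F_X)
  also have "\<dots> = (fps_X * F f) $ i" by (simp add: fps_mult_nth)
  finally show ?thesis by simp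
qed

lemma F_X_power_mult:
  "m + i < n \<Longrightarrow> F (fps_X ^ m * f) $ (m + i) = F f $ i"
proof (induction m)
  case (Suc m)
  have "F (fps_X ^ Suc m * f) $ (Suc m + i) = F (fps_X * (fps_X ^ m * f)) $ (Suc m + i)"
    by (simp add: mult.assoc)
  also have "\<dots> = F f $ i" using Suc by (subst F_X_mult) auto
  finally show ?case .
qed simp

text \<open>Multiplying by \<open>X^(n-1-k)\<close> moves everything above degree \<open>k\<close> beyond the truncation.\<close>
lemma F_cong_upto:
  assumes "k < n" "\<And>i. i \<le> k \<Longrightarrow> f $ i = g $ i"
  shows "F f $ k = F g $ k"
proof -
  have "F (fps_X ^ (n - 1 - k) * f) = F (fps_X ^ (n - 1 - k) * g)"
    using assms by (intro F_cong) (auto simp: fps_X_power_mult_nth)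
  then have "F (fps_X ^ (n - 1 - k) * f) $ ((n - 1 - k) + k) = F (fps_X ^ (n - 1 - k) * g) $ ((n - 1 - k) + k)"
    by simp
  then show ?thesis using assms(1) by (simp only: F_X_power_mult)
qed

lemma F_nth_0: "F f $ 0 = \<chi> (f $ 0)"
  using F_cong_upto[of 0 f "fps_const (f $ 0)"] n_gt F_const[of 0] by simp

text \<open>Splits an approximant of \<open>b X^j\<close> into a constant and, for positive
  \<open>j\<close>, a factor with constant term 1, so that multiplicativity applies to
  \<open>F_lim\<close>.\<close>

lemma const_shift:
  "fps_const (1 / of_nat (Suc m)) + fps_const b * fps_X ^ j
    = fps_const (1 / of_nat (Suc m)) * (1 + fps_const (of_nat (Suc m) * b) * fps_X ^ j :: complex fps)"
proof -
  have "fps_const (1 / of_nat (Suc m)) * (fps_const (of_nat (Suc m) * b) * fps_X ^ j)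
      = fps_const (1 / of_nat (Suc m) * (of_nat (Suc m) * b)) * (fps_X ^ j :: complex fps)"
    by (simp only: fps_const_mult[symmetric] mult.assoc)
  also have "1 / of_nat (Suc m) * (of_nat (Suc m) * b) = b"
    by (simp del: of_nat_Suc)
  finally show ?thesis by (simp add: distrib_left del: of_nat_Suc)
qed

text \<open>The degree 1 coefficient of \<open>F\<close> on \<open>1 + a X\<close> is additive in
  \<open>a\<close>, since products of such elements add the \<open>a\<close> modulo
  \<open>X^2\<close>. The limit at \<open>b X\<close> shows that \<open>\<chi>\<close> is a constant
  multiple of this additive function.\<close>

lemma \<chi>_add: "\<chi> (a + b) = \<chi> a + \<chi> b"
proof -
  define \<psi> where "\<psi> a = F (1 + fps_const a * fps_X) $ 1" for a
  have \<psi>_add: "\<psi> (a + b) = \<psi> a + \<psi> b" for a b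
  proof -
    have eq: "(1 + fps_const a * fps_X) * (1 + fps_const b * fps_X)
        = 1 + fps_const (a + b) * fps_X + fps_const (a * b) * (fps_X * fps_X :: complex fps)"
      by (simp add: algebra_simps flip: fps_const_add fps_const_mult)
    have "\<psi> (a + b) = F ((1 + fps_const a * fps_X) * (1 + fps_const b * fps_X)) $ 1"
      unfolding \<psi>_def eq using n_gt
      by (intro F_cong_upto) (auto simp: le_Suc_eq)
    also have "\<dots> = \<psi> a + \<psi> b"
      using n_gt by (subst F_mult) (auto simp: \<psi>_def fps_mult_nth F_nth_0 \<chi>_1)
    finally show ?thesis .
  qed
  have \<psi>_0: "\<psi> 0 = 0" using \<psi>_add[of 0 0] by simp
  have \<psi>_nat: "\<psi> (of_nat m * b) = of_nat m * \<psi> b" for m b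
    by (induction m) (auto simp: \<psi>_0 \<psi>_add algebra_simps)
  \<comment> \<open>The factor \<open>L m\<close> is not yet known to be 1: evaluating
    \<open>\<chi>\<close> at \<open>1 / of_nat (Suc m)\<close> requires the additivity being
    proved.\<close>
  define L where "L m = \<chi> (1 / of_nat (Suc m)) * of_nat (Suc m)" for m
  have lim: "(\<lambda>m. L m * \<psi> b) \<longlonglongrightarrow> \<chi> b" for b
  proof -
    have "F (fps_const (1 / of_nat (Suc m)) + fps_const b * fps_X ^ 1) $ 1 = L m * \<psi> b" for m
    proof -
      have "F (fps_const (1 / of_nat (Suc m)) + fps_const b * fps_X ^ 1) $ 1
          = \<chi> (1 / of_nat (Suc m)) * \<psi> (of_nat (Suc m) * b)"
        unfolding const_shift using n_gt
        by (subst F_mult) (auto simp: fps_mult_nth F_const \<psi>_def)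
      then show ?thesis unfolding L_def \<psi>_nat by simp
    qed
    moreover have "F (fps_const b * fps_X ^ 1) $ 1 = \<chi> b"
      using n_gt by (subst F_mult) (auto simp: fps_mult_nth F_const F_X)
    ultimately show ?thesis using F_lim[of 1 b 1] n_gt by simp
  qed
  \<comment> \<open>Otherwise the sequence for \<open>b = 1\<close> would be constantly 0 while
    tending to \<open>\<chi> 1 = 1\<close>.\<close>
  have c: "\<psi> 1 \<noteq> 0"
  proof
    assume "\<psi> 1 = 0"
    then have "(\<lambda>m. 0) \<longlonglongrightarrow> (1 :: complex)" using lim[of 1] by (simp add: \<chi>_1)
    then show False by (simp add: LIMSEQ_const_iff)
  qed
  have "(\<lambda>m. L m * \<psi> 1 / \<psi> 1) \<longlonglongrightarrow> 1 / \<psi> 1"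
    using tendsto_divide[OF lim[of 1] tendsto_const c] by (simp add: \<chi>_1)
  then have "L \<longlonglongrightarrow> 1 / \<psi> 1" using c by simp
  then have "(\<lambda>m. L m * \<psi> b) \<longlonglongrightarrow> 1 / \<psi> 1 * \<psi> b" for b
    by (intro tendsto_mult tendsto_const)
  then have "\<chi> b = 1 / \<psi> 1 * \<psi> b" for b
    using lim LIMSEQ_unique by blast
  then show ?thesis by (simp add: \<psi>_add add_divide_distrib)
qed

lemma \<chi>_sum: "\<chi> (sum f A) = (\<Sum>x\<in>A. \<chi> (f x))"
  by (induction A rule: infinite_finite_induct) (auto simp: \<chi>_0 \<chi>_add)

lemma \<chi>_inverse_nat: "\<chi> (1 / of_nat (Suc m)) = 1 / of_nat (Suc m)"
proof -
  have nat: "\<chi> (of_nat k) = of_nat k" for k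
    by (induction k) (auto simp: \<chi>_0 \<chi>_1 \<chi>_add)
  have "\<chi> (1 / of_nat (Suc m)) * of_nat (Suc m) = 1"
    using \<chi>_mult[of "1 / of_nat (Suc m)" "of_nat (Suc m)"] by (simp add: nat \<chi>_1 del: of_nat_Suc)
  then show ?thesis by (simp add: field_simps del: of_nat_Suc)
qed

text \<open>The error \<open>\<delta>\<close> at degree \<open>k\<close> is a derivation along
  \<open>\<chi>\<close>. It vanishes on constants and on nonunits, so it remains to treat series
  with constant term 1, since every unit is a constant times such a series.\<close>

lemma F_nth_step:
  assumes k: "0 < k" "k < n" and IH: "\<And>f i. i < k \<Longrightarrow> F f $ i = \<chi> (f $ i)"
  shows "F f $ k = \<chi> (f $ k)"
proof -
  define \<delta> where "\<delta> f = F f $ k - \<chi> (f $ k)" for f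
  have \<delta>_mult: "\<delta> (f * g) = \<chi> (f $ 0) * \<delta> g + \<chi> (g $ 0) * \<delta> f" for f g
  proof -
    obtain l where l: "k = Suc l" using k by (cases k) auto
    have "\<delta> (f * g) = (\<Sum>i=0..k. F f $ i * F g $ (k - i) - \<chi> (f $ i) * \<chi> (g $ (k - i)))"
      using k by (simp add: \<delta>_def F_mult fps_mult_nth \<chi>_sum \<chi>_mult sum_subtractf)
    \<comment> \<open>For \<open>0 < i < k\<close> both \<open>i\<close> and \<open>k - i\<close>
      lie below \<open>k\<close>, so \<open>IH\<close> cancels the term.\<close>
    also have "\<dots> = (\<Sum>i\<in>{0, k}. F f $ i * F g $ (k - i) - \<chi> (f $ i) * \<chi> (g $ (k - i)))"
      by (rule sum.mono_neutral_right) (auto simp: IH)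
    also have "\<dots> = \<chi> (f $ 0) * \<delta> g + \<chi> (g $ 0) * \<delta> f"
      using k by (simp add: \<delta>_def F_nth_0 algebra_simps)
    finally show ?thesis .
  qed
  have \<delta>_const: "\<delta> (fps_const a) = 0" for a
    using k by (simp add: \<delta>_def F_const \<chi>_0)
  have \<delta>_nonunit: "\<delta> f = 0" if "f $ 0 = 0" for f
  proof -
    \<comment> \<open>Cancelling one factor \<open>X\<close> lowers the degree to
      \<open>k - 1\<close>, where \<open>IH\<close> applies.\<close>
    have "f = fps_X * fps_shift 1 f" using that
      by (auto simp: fps_eq_iff)
    then have "F f $ k = F (fps_shift 1 f) $ (k - 1)"
      using F_X_mult[of k "fps_shift 1 f"] k by simp
    also have "\<dots> = \<chi> (f $ k)" using k by (simp add: IH)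
    finally show ?thesis by (simp add: \<delta>_def)
  qed
  \<comment> \<open>Descending induction on \<open>j\<close>, where \<open>f\<close> is 1 up to
    terms of degree at least \<open>j\<close>. At \<open>j = k + 1\<close> such an \<open>f\<close>
    cannot be told from 1 up to degree \<open>k\<close>.\<close>
  have \<delta>_unipotent: "\<delta> f = 0" if "j \<le> k + 1" "0 < j" "f $ 0 = 1" "\<And>i. 0 < i \<Longrightarrow> i < j \<Longrightarrow> f $ i = 0" for f j
    using that
  proof (induction j arbitrary: f rule: inc_induct)
    case base
    have "F f $ k = F 1 $ k" using k base by (intro F_cong_upto) auto
    then show ?case using k base by (simp add: \<delta>_def F_1 \<chi>_0)
  next
    case (step j)
    have u1: "(1 + fps_const a * fps_X ^ j) $ 0 = 1" for a :: complex
      using step.prems(1) by simp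
    \<comment> \<open>Only the coefficient at \<open>j\<close> matters: dividing by
      \<open>1 + a X^j\<close> leaves a quotient that is 1 up to degree \<open>j\<close>, on which
      the induction hypothesis kills \<open>\<delta>\<close>.\<close>
    have split: "\<delta> f = \<delta> (1 + fps_const a * fps_X ^ j)"
      if f: "f $ 0 = 1" "\<And>i. 0 < i \<Longrightarrow> i < j \<Longrightarrow> f $ i = 0" "f $ j = a" for f a
    proof -
      define p where "p = 1 + fps_const a * fps_X ^ j"
      define h where "h = fps_shift (Suc j) f"
      have p0: "p $ 0 = 1" using u1 by (simp add: p_def)
      have f_eq: "f = p + fps_X ^ Suc j * h"
        using f step.prems(1)
        by (auto simp: fps_eq_iff p_def h_def fps_X_power_mult_nth not_less simp del: power_Suc)
      \<comment> \<open>The quotient of \<open>f\<close> by \<open>p\<close>; \<open>p\<close> is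
        invertible because its constant term is 1.\<close>
      define u where "u = 1 + fps_X ^ Suc j * (h * inverse p)"
      have "f = p * u"
      proof -
        have "p * u = p + fps_X ^ Suc j * (h * (inverse p * p))"
          unfolding u_def by (simp only: ring_distribs mult_1_right mult_1_left mult_ac)
        also have "inverse p * p = 1" using p0 by (simp add: inverse_mult_eq_1)
        finally show ?thesis by (simp add: f_eq)
      qed
      moreover have u: "u $ 0 = 1" "\<And>i. 0 < i \<Longrightarrow> i < Suc j \<Longrightarrow> u $ i = 0"
        by (auto simp: u_def fps_X_power_mult_nth simp del: power_Suc)
      then have "\<delta> u = 0" by (intro step.IH) auto
      ultimately show ?thesis by (simp add: \<delta>_mult p0 u(1) \<chi>_1 flip: p_def)
    qed
    define \<psi> where "\<psi> a = \<delta> (1 + fps_const a * fps_X ^ j)" for a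
    have \<psi>_add: "\<psi> (a + b) = \<psi> a + \<psi> b" for a b
    proof -
      \<comment> \<open>The mixed term has degree \<open>2 j > j\<close>, so \<open>split\<close>
        ignores it.\<close>
      have eq: "(1 + fps_const a * fps_X ^ j) * (1 + fps_const b * fps_X ^ j)
        = 1 + fps_const (a + b) * fps_X ^ j + fps_X ^ j * (fps_X ^ j * fps_const (a * b) :: complex fps)"
        by (simp add: algebra_simps flip: fps_const_add fps_const_mult)
      have "\<psi> (a + b) = \<delta> ((1 + fps_const a * fps_X ^ j) * (1 + fps_const b * fps_X ^ j))"
        unfolding \<psi>_def eq using step.prems(1)
        by (intro split[symmetric]) (auto simp: fps_X_power_mult_nth)
      also have "\<dots> = \<psi> a + \<psi> b"
        by (simp only: \<delta>_mult u1 \<chi>_1 \<psi>_def) simp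
      finally show ?thesis .
    qed
    have \<psi>_0: "\<psi> 0 = 0" using \<psi>_add[of 0 0] by simp
    have \<psi>_nat: "\<psi> (of_nat m * b) = of_nat m * \<psi> b" for m b
      by (induction m) (auto simp: \<psi>_0 \<psi>_add algebra_simps)
    have "\<psi> b = 0" for b
    proof -
      \<comment> \<open>The factor \<open>Suc m\<close> from additivity cancels
        \<open>\<chi> (1 / of_nat (Suc m))\<close>, so the sequence is constantly
        \<open>\<psi> b\<close>; its limit is \<open>\<delta>\<close> of a nonunit, hence 0.\<close>
      have "\<delta> (fps_const (1 / of_nat (Suc m)) + fps_const b * fps_X ^ j) = \<psi> b" for m
        unfolding const_shift \<delta>_mult \<delta>_const
        by (simp add: \<psi>_def[symmetric] \<psi>_nat \<chi>_inverse_nat del: of_nat_Suc)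
      moreover have "(\<lambda>m. \<delta> (fps_const (1 / of_nat (Suc m)) + fps_const b * fps_X ^ j))
          \<longlonglongrightarrow> \<delta> (fps_const b * fps_X ^ j)"
        \<comment> \<open>As \<open>k > 0\<close>, coefficient \<open>k\<close> of the approximant
          itself does not depend on \<open>m\<close>; only the \<open>F\<close> part needs a
          limit.\<close>
        unfolding \<delta>_def using k F_lim[of k b j]
        by (intro tendsto_diff) (auto simp: fps_X_power_mult_nth)
      moreover have "\<delta> (fps_const b * fps_X ^ j) = 0"
        using step.prems(1) by (intro \<delta>_nonunit) simp
      ultimately show ?thesis by (simp add: LIMSEQ_const_iff)
    qed
    then show ?case using split[of f "f $ j"] step.prems by (simp add: \<psi>_def)
  qed
  have "\<delta> f = 0"
  proof (cases "f $ 0 = 0")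
    case False
    define g where "g = fps_const (1 / f $ 0) * f"
    have "fps_const (f $ 0) * g = fps_const (f $ 0 * (1 / f $ 0)) * f"
      unfolding g_def by (simp only: fps_const_mult[symmetric] mult.assoc)
    then have "f = fps_const (f $ 0) * g" using False by simp
    \<comment> \<open>For \<open>j = 1\<close> the condition on intermediate coefficients is
      empty.\<close>
    moreover have "\<delta> g = 0" using False \<delta>_unipotent[of 1 g] by (simp add: g_def)
    ultimately show ?thesis using \<delta>_mult[of "fps_const (f $ 0)" g] \<delta>_const by simp
  qed (rule \<delta>_nonunit)
  then show ?thesis by (simp add: \<delta>_def)
qed

lemma F_nth: "k < n \<Longrightarrow> F f $ k = \<chi> (f $ k)"
proof (induction k arbitrary: f rule: less_induct)
  case (less k)
  then show ?case using F_nth_step[of k f] F_nth_0 by (cases "k = 0") auto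
qed

lemma \<chi>_id_or_cnj: "\<chi> = (\<lambda>z. z) \<or> \<chi> = cnj"
  by (intro isometric_ring_endo_complex \<chi>_add \<chi>_mult \<chi>_1 norm_\<chi>)

end

subsection \<open>Multiplicative maps on the Toeplitz algebra\<close>

text \<open>Every value of \<open>\<phi>\<close> commutes with
  \<open>\<phi> (jordanS n) = jordanS n\<close>, hence is Toeplitz; reading off row 0 turns
  \<open>\<phi>\<close> into an instance of \<open>truncated_endo\<close>.\<close>

lemma multiplicative_fixing_jordanS:
  fixes \<phi> :: "complex mat \<Rightarrow> complex mat"
  assumes n: "n > 1"
    and into: "\<And>A. A \<in> toeplitz_alg n \<Longrightarrow> \<phi> A \<in> carrier_mat n n"
    and cont: "\<And>A \<epsilon>. A \<in> toeplitz_alg n \<Longrightarrow> \<epsilon> > 0 \<Longrightarrow>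
                 \<exists>\<delta>>0. \<forall>B\<in>toeplitz_alg n. opnorm (B - A) < \<delta> \<longrightarrow> opnorm (\<phi> B - \<phi> A) < \<epsilon>"
    and mult: "\<And>A B. A \<in> toeplitz_alg n \<Longrightarrow> B \<in> toeplitz_alg n \<Longrightarrow> \<phi> (A * B) = \<phi> A * \<phi> B"
    and norm: "\<And>A. A \<in> toeplitz_alg n \<Longrightarrow> opnorm (\<phi> A) = opnorm A"
    and fix_S: "\<phi> (jordanS n) = jordanS n"
  shows "(\<forall>A\<in>toeplitz_alg n. \<phi> A = A) \<or> (\<forall>A\<in>toeplitz_alg n. \<phi> A = mat_conj A)"
proof -
  define F where "F f = Abs_fps (\<lambda>k. \<phi> (toeplitz_mat n f) $$ (0, k))" for f
  define \<chi> where "\<chi> a = F (fps_const a) $ 0" for a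
  have alg: "toeplitz_mat n f \<in> toeplitz_alg n" for f by (auto simp: toeplitz_alg_eq_range)
  have carr: "\<phi> (toeplitz_mat n f) \<in> carrier_mat n n" for f by (intro into alg)
  have \<phi>_eq: "\<phi> (toeplitz_mat n f) = toeplitz_mat n (F f)" for f
    unfolding F_def
  proof (rule commute_jordanS_imp_toeplitz[OF carr])
    have "\<phi> (toeplitz_mat n (f * fps_X)) = \<phi> (toeplitz_mat n (fps_X * f))" by (simp add: mult.commute)
    then show "\<phi> (toeplitz_mat n f) * jordanS n = jordanS n * \<phi> (toeplitz_mat n f)"
      by (simp add: toeplitz_mat_mult mult alg toeplitz_mat_X[symmetric])
        (simp add: toeplitz_mat_X fix_S)
  qed
  have F_mult: "F (f * g) $ i = (F f * F g) $ i" if "i < n" for f g i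
    using that by (intro toeplitz_mat_eqD)
      (simp_all add: toeplitz_mat_mult mult alg flip: \<phi>_eq)
  have F_X: "F fps_X $ i = fps_X $ i" if "i < n" for i
    using that by (intro toeplitz_mat_eqD)
      (simp_all add: toeplitz_mat_X fix_S flip: \<phi>_eq)
  have F_X_power: "F (fps_X ^ Suc k) $ i = fps_X ^ Suc k $ i" if "i < n" for i k
  proof -
    have "toeplitz_mat n (F (fps_X ^ Suc k)) = toeplitz_mat n (fps_X ^ Suc k)"
    proof (induction k)
      case (Suc k)
      have "toeplitz_mat n (F (fps_X ^ Suc (Suc k)))
          = toeplitz_mat n (F fps_X) * toeplitz_mat n (F (fps_X ^ Suc k))"
        unfolding \<phi>_eq[symmetric] power_Suc[of _ "Suc k"] by (simp only: toeplitz_mat_mult mult alg)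
      also have "toeplitz_mat n (F fps_X) = toeplitz_mat n fps_X"
        by (intro toeplitz_mat_cong F_X)
      finally show ?case
        by (simp only: Suc.IH flip: toeplitz_mat_mult power_Suc)
    qed (use F_X in \<open>auto intro: toeplitz_mat_cong\<close>)
    then show ?thesis using that by (rule toeplitz_mat_eqD)
  qed
  have norm_\<chi>: "cmod (\<chi> a) = cmod a" for a
  proof -
    \<comment> \<open>Multiplication by \<open>X^(n-1)\<close> retains only the constant
      coefficient, so \<open>\<phi>\<close> sends \<open>a\<close> times \<open>N\<close> to
      \<open>\<chi> a\<close> times \<open>N\<close>, and comparing norms gives the modulus of
      \<open>\<chi> a\<close>.\<close>
    define N where "N = toeplitz_mat n (fps_X ^ (n - 1))"
    have N_const: "toeplitz_mat n (g * fps_X ^ (n - 1)) = g $ 0 \<cdot>\<^sub>m N" for g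
      unfolding N_def
      by (intro eq_matI) (auto simp: toeplitz_mat_index fps_X_power_mult_right_nth)
    have \<phi>N: "\<phi> N = N"
      unfolding N_def \<phi>_eq using F_X_power[of _ "n - 2"] n
      by (intro toeplitz_mat_cong) (simp add: Suc_diff_Suc numeral_2_eq_2)
    have "\<phi> (toeplitz_mat n (fps_const a * fps_X ^ (n - 1))) = toeplitz_mat n (F (fps_const a)) * \<phi> N"
      unfolding N_def by (simp only: toeplitz_mat_mult mult alg \<phi>_eq)
    also have "\<dots> = toeplitz_mat n (F (fps_const a) * fps_X ^ (n - 1))"
      unfolding \<phi>N by (simp add: N_def toeplitz_mat_mult)
    finally have "\<phi> (a \<cdot>\<^sub>m N) = \<chi> a \<cdot>\<^sub>m N" unfolding N_const by (simp add: \<chi>_def)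
    then have "opnorm (\<chi> a \<cdot>\<^sub>m N) = opnorm (a \<cdot>\<^sub>m N)"
      using norm[OF alg, of "fps_const a * fps_X ^ (n - 1)"] unfolding N_const by simp
    moreover have "N \<in> carrier_mat n n" "opnorm N \<noteq> 0"
      using opnorm_toeplitz_X_power_ge[of n] n by (auto simp: N_def)
    ultimately show ?thesis by (simp add: opnorm_smult[of N n n])
  qed
  text \<open>The last column of \<open>\<phi> (a I)\<close> has norm at most \<open>\<bar>a\<bar>\<close>, which its diagonal entry already exhausts.\<close>
  have F_const: "F (fps_const a) $ i = (if i = 0 then \<chi> a else 0)" if i: "i < n" for a i
  proof (cases "i = 0")
    case False
    define c where "c k = F (fps_const a) $ k" for k
    have "(vnorm (col (toeplitz_mat n (F (fps_const a))) (n - 1)))\<^sup>2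
        = (\<Sum>k<n. (cmod (c (n - 1 - k)))\<^sup>2)"
      unfolding vnorm_power2 using n by (intro sum.cong) (auto simp: toeplitz_mat_index c_def)
    also have "\<dots> = (\<Sum>k<n. (cmod (c k))\<^sup>2)"
      using n by (intro sum.reindex_bij_witness[of _ "\<lambda>k. n - 1 - k" "\<lambda>k. n - 1 - k"]) auto
    finally have sum: "(vnorm (col (toeplitz_mat n (F (fps_const a))) (n - 1)))\<^sup>2 = (\<Sum>k<n. (cmod (c k))\<^sup>2)" .
    have "vnorm (col (toeplitz_mat n (F (fps_const a))) (n - 1)) \<le> opnorm (toeplitz_mat n (F (fps_const a)))"
      using n by (intro vnorm_col_le_opnorm[of _ n n]) auto
    also have "\<dots> \<le> cmod a"
      using norm[OF alg, of "fps_const a"] opnorm_toeplitz_const[of n a] by (simp add: \<phi>_eq)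
    finally have "(\<Sum>k<n. (cmod (c k))\<^sup>2) \<le> (cmod a)\<^sup>2"
      unfolding sum[symmetric] by (intro power_mono) auto
    moreover have "(\<Sum>k\<in>{0, i}. (cmod (c k))\<^sup>2) \<le> (\<Sum>k<n. (cmod (c k))\<^sup>2)"
      using i n by (intro sum_mono2) auto
    ultimately have "(cmod (\<chi> a))\<^sup>2 + (cmod (c i))\<^sup>2 \<le> (cmod a)\<^sup>2"
      using False by (simp add: c_def \<chi>_def)
    then have "(cmod (c i))\<^sup>2 \<le> 0" by (simp add: norm_\<chi>)
    then show ?thesis using False by (simp add: c_def)
  qed (simp add: \<chi>_def)
  have F_lim: "(\<lambda>m. F (fps_const (1 / of_nat (Suc m)) + fps_const b * fps_X ^ j) $ i)
      \<longlonglongrightarrow> F (fps_const b * fps_X ^ j) $ i" if i: "i < n" for b i j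
  proof (rule LIMSEQ_I)
    fix \<epsilon> :: real assume "\<epsilon> > 0"
    define g where "g = fps_const b * fps_X ^ j"
    define h where "h m = fps_const (1 / complex_of_nat (Suc m)) + g" for m
    obtain \<delta> where \<delta>: "\<delta> > 0" "\<And>B. B \<in> toeplitz_alg n \<Longrightarrow> opnorm (B - toeplitz_mat n g) < \<delta> \<Longrightarrow>
        opnorm (\<phi> B - \<phi> (toeplitz_mat n g)) < \<epsilon>"
      using cont[OF alg \<open>\<epsilon> > 0\<close>, of g] by blast
    obtain M where M: "1 / real (Suc M) < \<delta>"
      using reals_Archimedean[OF \<delta>(1)] by (auto simp: inverse_eq_divide)
    have "cmod (F (h m) $ i - F g $ i) < \<epsilon>" if "m \<ge> M" for m
    proof -
      have "toeplitz_mat n (h m) - toeplitz_mat n g = toeplitz_mat n (fps_const (1 / of_nat (Suc m)))"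
        unfolding h_def toeplitz_mat_add by (intro eq_matI) auto
      then have "opnorm (toeplitz_mat n (h m) - toeplitz_mat n g) \<le> 1 / real (Suc m)"
        using opnorm_toeplitz_const[of n "1 / of_nat (Suc m)"] by (simp add: norm_divide del: of_nat_Suc)
      also have "\<dots> \<le> 1 / real (Suc M)" using that by (simp add: frac_le)
      finally have "opnorm (\<phi> (toeplitz_mat n (h m)) - \<phi> (toeplitz_mat n g)) < \<epsilon>"
        using M by (intro \<delta>(2) alg) simp
      \<comment> \<open>Entries are dominated by the operator norm, which turns norm continuity into
        convergence of coefficients.\<close>
      moreover have "cmod ((\<phi> (toeplitz_mat n (h m)) - \<phi> (toeplitz_mat n g)) $$ (0, i))
          \<le> opnorm (\<phi> (toeplitz_mat n (h m)) - \<phi> (toeplitz_mat n g))"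
        using n i by (intro cmod_index_le_opnorm[of _ n n] minus_carrier_mat carr) auto
      ultimately show ?thesis using n i by (simp add: \<phi>_eq toeplitz_mat_index)
    qed
    then show "\<exists>M. \<forall>m\<ge>M. cmod (F (fps_const (1 / of_nat (Suc m)) + fps_const b * fps_X ^ j) $ i
        - F (fps_const b * fps_X ^ j) $ i) < \<epsilon>"
      unfolding h_def g_def by blast
  qed
  interpret truncated_endo n F \<chi>
  proof
    \<comment> \<open>\<open>F f\<close> is computed from \<open>toeplitz_mat n f\<close> alone, so
      the equality holds at all degrees.\<close>
    show "F f = F g" if "\<And>i. i < n \<Longrightarrow> f $ i = g $ i" for f g
      using toeplitz_mat_cong[OF that] by (simp add: F_def)
  qed (fact n F_mult F_X F_const norm_\<chi> F_lim)+
  from \<chi>_id_or_cnj show ?thesis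
  proof
    assume id: "\<chi> = (\<lambda>z. z)"
    have "\<phi> (toeplitz_mat n f) = toeplitz_mat n f" for f
      unfolding \<phi>_eq by (intro toeplitz_mat_cong) (simp add: F_nth id)
    then show ?thesis by (auto simp: toeplitz_alg_eq_range)
  next
    assume cnj: "\<chi> = cnj"
    have "\<phi> (toeplitz_mat n f) = mat_conj (toeplitz_mat n f)" for f
      unfolding \<phi>_eq by (intro eq_matI) (auto simp: toeplitz_mat_index F_nth cnj mat_conj_def)
    then show ?thesis by (auto simp: toeplitz_alg_eq_range)
  qed
qed

theorem theorem2p5:
  fixes n :: nat and \<phi> :: "complex mat \<Rightarrow> complex mat"
  assumes "n > 1"
    and into: "\<And>A. A \<in> toeplitz_alg n \<Longrightarrow> \<phi> A \<in> carrier_mat n n"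
    and cont: "\<And>A \<epsilon>. A \<in> toeplitz_alg n \<Longrightarrow> \<epsilon> > 0 \<Longrightarrow>
                 \<exists>\<delta>>0. \<forall>B\<in>toeplitz_alg n. opnorm (B - A) < \<delta> \<longrightarrow> opnorm (\<phi> B - \<phi> A) < \<epsilon>"
    and mult: "\<And>A B. A \<in> toeplitz_alg n \<Longrightarrow> B \<in> toeplitz_alg n \<Longrightarrow> \<phi> (A * B) = \<phi> A * \<phi> B"
    and norm: "\<And>A. A \<in> toeplitz_alg n \<Longrightarrow> opnorm (\<phi> A) = opnorm A"
  shows "\<exists>U. unitary_mat n U \<and>
           ((\<forall>A\<in>toeplitz_alg n. \<phi> A = U * A * mat_adj U) \<or>
            (\<forall>A\<in>toeplitz_alg n. \<phi> A = U * mat_conj A * mat_adj U))"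
proof -
  define T where "T = \<phi> (jordanS n)"
  have alg: "toeplitz_mat n f \<in> toeplitz_alg n" for f by (auto simp: toeplitz_alg_eq_range)
  have T: "T \<in> carrier_mat n n"
    unfolding T_def toeplitz_mat_X[symmetric] by (intro into alg)
  \<comment> \<open>Powers start at 1 because \<open>\<phi>\<close> of the identity is not known to
    be the identity at this point.\<close>
  have pow: "\<phi> (toeplitz_mat n (fps_X ^ Suc k)) = T ^\<^sub>m Suc k" for k
  proof (induction k)
    case 0
    show ?case using T by (simp add: toeplitz_mat_X T_def)
  next
    case (Suc k)
    have "\<phi> (toeplitz_mat n (fps_X ^ Suc (Suc k))) = \<phi> (toeplitz_mat n (fps_X ^ Suc k)) * T"
      unfolding power_Suc2[of _ "Suc k"] T_def toeplitz_mat_X[symmetric]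
      by (simp only: toeplitz_mat_mult mult alg)
    then show ?case by (simp only: Suc.IH pow_mat.simps)
  qed
  have "T ^\<^sub>m n = 0\<^sub>m n n"
  proof (rule opnorm_eq_0)
    have zero: "toeplitz_mat n (fps_X ^ n) = 0\<^sub>m n n"
      unfolding toeplitz_mat_0[symmetric] by (intro toeplitz_mat_cong) auto
    show "opnorm (T ^\<^sub>m n) = 0"
      using pow[of "n - 1"] norm[OF alg, of "fps_X ^ n"] \<open>n > 1\<close> by (simp add: zero opnorm_zero)
  qed (use T in simp)
  moreover have "opnorm (T ^\<^sub>m (n - 1)) \<ge> 1"
    \<comment> \<open>\<open>Suc (n - 2)\<close> is \<open>n - 1\<close> because
      \<open>n > 1\<close>.\<close>
    using pow[of "n - 2"] norm[OF alg, of "fps_X ^ (n - 1)"] opnorm_toeplitz_X_power_ge[of n] \<open>n > 1\<close>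
    by (simp add: Suc_diff_Suc numeral_2_eq_2)
  moreover have "opnorm T \<le> 1"
    using norm[OF alg, of fps_X] opnorm_jordanS_le[of n] by (simp add: T_def toeplitz_mat_X)
  ultimately obtain U where U: "unitary_mat n U" and TU: "T * U = U * jordanS n"
    using unitary_equiv_jordanS[OF T] \<open>n > 1\<close> by auto
  have U': "U \<in> carrier_mat n n" "mat_adj U \<in> carrier_mat n n"
    "U * mat_adj U = 1\<^sub>m n" "mat_adj U * U = 1\<^sub>m n"
    using U by (auto simp: unitary_mat_def)
  \<comment> \<open>By \<open>TU\<close> this conjugate of \<open>\<phi>\<close> fixes
    \<open>jordanS n\<close>, and unitarity transfers multiplicativity, continuity and norm
    preservation to it.\<close>
  define \<psi> where "\<psi> A = mat_adj U * \<phi> A * U" for A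
  have "(\<forall>A\<in>toeplitz_alg n. \<psi> A = A) \<or> (\<forall>A\<in>toeplitz_alg n. \<psi> A = mat_conj A)"
  proof (rule multiplicative_fixing_jordanS[OF \<open>n > 1\<close>])
    show "\<psi> A \<in> carrier_mat n n" if "A \<in> toeplitz_alg n" for A
      unfolding \<psi>_def by (intro mult_carrier_mat[of _ n n] into that U')
    show "opnorm (\<psi> A) = opnorm A" if "A \<in> toeplitz_alg n" for A
      using opnorm_unitary_conj[OF U into[OF that]] norm[OF that] by (simp add: \<psi>_def)
    show "\<psi> (A * B) = \<psi> A * \<psi> B" if "A \<in> toeplitz_alg n" "B \<in> toeplitz_alg n" for A B
    proof -
      have "\<psi> A * \<psi> B = mat_adj U * \<phi> A * (U * mat_adj U) * \<phi> B * U"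
        unfolding \<psi>_def using U'(1,2) into[OF that(1)] into[OF that(2)]
        by (simp add: assoc_mult_mat[of _ n n _ n _ n] mult_carrier_mat[of _ n n _ n])
      also have "\<dots> = \<psi> (A * B)"
        unfolding \<psi>_def mult[OF that] U'(3) using U'(1,2) into[OF that(1)] into[OF that(2)]
        by (simp add: assoc_mult_mat[of _ n n _ n _ n] mult_carrier_mat[of _ n n _ n])
      finally show ?thesis ..
    qed
    show "\<psi> (jordanS n) = jordanS n"
    proof -
      have S: "jordanS n \<in> carrier_mat n n" by (simp add: jordanS_def)
      have "\<psi> (jordanS n) = mat_adj U * (T * U)"
        unfolding \<psi>_def T_def[symmetric] using U'(1,2) T by (intro assoc_mult_mat)
      also have "\<dots> = mat_adj U * U * jordanS n"
        unfolding TU using U'(1,2) S by (simp add: assoc_mult_mat[of _ n n _ n _ n] mult_carrier_mat[of _ n n _ n])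
      finally show ?thesis using U'(4) S by simp
    qed
    show "\<exists>\<delta>>0. \<forall>B\<in>toeplitz_alg n. opnorm (B - A) < \<delta> \<longrightarrow> opnorm (\<psi> B - \<psi> A) < \<epsilon>"
      if A: "A \<in> toeplitz_alg n" and "\<epsilon> > 0" for A \<epsilon>
    proof -
      have "opnorm (\<psi> B - \<psi> A) = opnorm (\<phi> B - \<phi> A)" if B: "B \<in> toeplitz_alg n" for B
      proof -
        have "\<psi> B - \<psi> A = mat_adj U * (\<phi> B - \<phi> A) * U"
          unfolding \<psi>_def mult_minus_distrib_mat[OF U'(2) into[OF B] into[OF A]]
          by (rule minus_mult_distrib_mat[OF mult_carrier_mat[OF U'(2) into[OF B]]
                mult_carrier_mat[OF U'(2) into[OF A]] U'(1), symmetric])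
        then show ?thesis using opnorm_unitary_conj[OF U minus_carrier_mat[OF into[OF A]]] by simp
      qed
      then show ?thesis using cont[OF A \<open>\<epsilon> > 0\<close>] by simp
    qed
  qed
  moreover have "\<phi> A = U * \<psi> A * mat_adj U" if "A \<in> toeplitz_alg n" for A
    unfolding \<psi>_def by (rule unitary_conj_cancel[OF U into[OF that], symmetric])
  ultimately show ?thesis using U by metis
qed

end
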